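(* Let $a,b,c,d\ge0$, not all zero, with $a+c=b+d$, and put $p=\frac a{a+c}$, $r=\frac b{b+d}$, $\lambda(p,r)=\max(|1-2p|,|1-2r|)$. Let $\mu$ be any probability measure on $\{0,1\}^{\mathbb Z}$, let $(e(i,t))_{i\in\mathbb Z,t\in\mathbb N}\sim\mathcal L(\mu;p,r)$, and let $C$ be its edge correlation function. Then for all $i\in\mathbb Z$ and $t\in\mathbb N$ such that $\mathrm{Var}(e(0,0))>0$ and $\mathrm{Var}(e(i,t))>0$, and such that $t\ge1$ or $\lambda(p,r)>0$, $$\left|\sqrt{\frac{\mathrm{Var}(e(i,t))}{\mathrm{Var}(e(0,0))}}\;C((0,0);(i,t))-C_8(i,t)\right|\le2\left(\lambda(p,r)^{t-1-\lfloor t/2\rfloor}+\lambda(p,r)^{\lfloor t/2\rfloor}-\lambda(p,r)^{t-1}\right).$$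
   Context: $\mathbb N=\{0,1,2,\dots\}$; $0^0=1$. $\mathrm{PM}(1/2)$ is the law on $\{0,1\}^{\mathbb Z}$ of i.i.d. Bernoulli$(1/2)$ variables indexed by $\mathbb Z$. The law $\mathcal L(\mu;p,r)$, for $\mu$ a probability measure on $\{0,1\}^{\mathbb Z}$ and $p,r\in[0,1]$, is the law of the random field $(e(i,t))_{i\in\mathbb Z,t\in\mathbb N}\in\{0,1\}^{\mathbb Z\times\mathbb N}$ such that $(e(i,0))_{i\in\mathbb Z}\sim\mu$ and $(e(\cdot,t))_{t\ge0}$ is a Markov chain such that, given line $t$, independently for all $i\in\mathbb Z$ with $i+t$ even, the pair $(e(i,t+1),e(i+1,t+1))$ depends only on $(e(i,t),e(i+1,t))$, with, for $k\in\{0,1\}$: $(k,k)\mapsto(k,k)$ with probability $r$ and $(k,k)\mapsto(1-k,1-k)$ with probability $1-r$; $(k,1-k)\mapsto(1-k,k)$ with probability $p$ and $(k,1-k)\mapsto(k,1-k)$ with probability $1-p$. For $(e(i,t))\sim\mathcal L(\mu;p,r)$ the edge correlation function is $$C((i,t);(i',t'))=\frac{\mathrm{Cov}(e(i,t),e(i',t'))}{\sqrt{\mathrm{Var}(e(i,t))}\sqrt{\mathrm{Var}(e(i',t'))}}.$$ $C_8(i,t)$ denotes $C((0,0);(i,t))$ in the special case $\mu=\mathrm{PM}(1/2)$ with the same $p,r$. *)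

theory Defs
  imports "HOL-Probability.Probability"
begin

text \<open>
  The state space is \<open>{0,1}\<close>, represented by \<^typ>\<open>bool\<close> (so \<open>1 - k\<close> is \<open>\<not> k\<close>);
  \<^const>\<open>of_bool\<close> is applied wherever numerical values are needed.
  The definitions are meant for \<open>p, r \<in> [0,1]\<close>; \<^const>\<open>bernoulli_pmf\<close> clamps other values.
\<close>

definition line_space :: "(int \<Rightarrow> bool) measure" where
  "line_space = PiM UNIV (\<lambda>_. count_space UNIV)"

definition field_space :: "(int \<times> nat \<Rightarrow> bool) measure" where
  "field_space = PiM UNIV (\<lambda>_. count_space UNIV)"

definition PM_half :: "(int \<Rightarrow> bool) measure" where
  "PM_half = PiM UNIV (\<lambda>_. measure_pmf (bernoulli_pmf (1/2)))"

definition pair_step :: "real \<Rightarrow> real \<Rightarrow> bool \<times> bool \<Rightarrow> (bool \<times> bool) pmf" where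
  "pair_step p r = (\<lambda>(k, l).
      if k = l
      then map_pmf (\<lambda>s. if s then (k, k) else (\<not> k, \<not> k)) (bernoulli_pmf r)
      else map_pmf (\<lambda>s. if s then (l, k) else (k, l)) (bernoulli_pmf p))"

text \<open>
  Line \<open>t + 1\<close> given line \<open>t\<close>: the new pairs at positions \<open>(i, i + 1)\<close> with \<open>i + t\<close> even are
  drawn independently. They tile the line; site \<open>j\<close> is the left entry of the pair of
  index \<open>j\<close> if \<open>j + t\<close> is even, and the right entry of the pair of index \<open>j - 1\<close> otherwise.
\<close>

definition join_pairs :: "nat \<Rightarrow> (int \<Rightarrow> bool \<times> bool) \<Rightarrow> int \<Rightarrow> bool" where
  "join_pairs t w j = (if even (j + int t) then fst (w j) else snd (w (j - 1)))"

definition line_kernel :: "real \<Rightarrow> real \<Rightarrow> nat \<Rightarrow> (int \<Rightarrow> bool) \<Rightarrow> (int \<Rightarrow> bool) measure" where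
  "line_kernel p r t x =
     distr (PiM {i. even (i + int t)} (\<lambda>i. measure_pmf (pair_step p r (x i, x (i + 1)))))
       line_space (join_pairs t)"

text \<open>
  Transition kernels in the form expected by \<^locale>\<open>Ionescu_Tulcea\<close>: the law of line \<open>n\<close>
  given the history \<open>h 0, \<dots>, h (n - 1)\<close>.
\<close>

fun chain_kernel ::
  "(int \<Rightarrow> bool) measure \<Rightarrow> real \<Rightarrow> real \<Rightarrow> nat \<Rightarrow> (nat \<Rightarrow> int \<Rightarrow> bool) \<Rightarrow> (int \<Rightarrow> bool) measure"
where
  "chain_kernel \<mu> p r 0 h = \<mu>"
| "chain_kernel \<mu> p r (Suc t) h = line_kernel p r t (h t)"

text \<open>
  The kernels meet the hypotheses of the Ionescu-Tulcea theorem, so the limit in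
  \<open>chain_law\<close> below has the intended finite-dimensional distributions.
\<close>

lemma space_line_space [simp]: "space line_space = UNIV"
  by (simp add: line_space_def space_PiM)

lemma measurable_join_pairs [measurable]:
  "join_pairs t \<in> measurable (PiM {i. even (i + int t)} (\<lambda>i. measure_pmf (q i))) line_space"
  unfolding line_space_def
proof (rule measurable_PiM_single')
  fix j :: int
  let ?I = "{i. even (i + int t)}"
  show "(\<lambda>w. join_pairs t w j) \<in> measurable (PiM ?I (\<lambda>i. measure_pmf (q i))) (count_space UNIV)"
  proof (cases "even (j + int t)")
    case True
    then have "(\<lambda>w. w j) \<in> measurable (PiM ?I (\<lambda>i. measure_pmf (q i))) (measure_pmf (q j))"
      by (intro measurable_component_singleton) auto
    then have "(\<lambda>w. fst (w j)) \<in> measurable (PiM ?I (\<lambda>i. measure_pmf (q i))) (count_space UNIV)"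
      by (rule measurable_compose) simp
    with True show ?thesis by (simp add: join_pairs_def)
  next
    case False
    then have "(\<lambda>w. w (j - 1)) \<in> measurable (PiM ?I (\<lambda>i. measure_pmf (q i))) (measure_pmf (q (j - 1)))"
      by (intro measurable_component_singleton) auto
    then have "(\<lambda>w. snd (w (j - 1))) \<in> measurable (PiM ?I (\<lambda>i. measure_pmf (q i))) (count_space UNIV)"
      by (rule measurable_compose) simp
    with False show ?thesis by (simp add: join_pairs_def)
  qed
qed auto

lemma prob_space_line_kernel: "prob_space (line_kernel p r t x)"
  unfolding line_kernel_def
  by (intro prob_space.prob_space_distr prob_space_PiM measurable_join_pairs)
     (rule prob_space_measure_pmf)

lemma measurable_line_kernel:
  "line_kernel p r t \<in> measurable line_space (subprob_algebra line_space)"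
proof -
  let ?I = "{i. even (i + int t)}"
  let ?P = "PiM ?I (\<lambda>_. count_space UNIV :: (bool \<times> bool) measure)"
  let ?Q = "\<lambda>x i. measure_pmf (pair_step p r (x i, x (i + 1)))"
  let ?K = "\<lambda>x. PiM ?I (?Q x)"
  have Q: "prob_space (?Q x i)" for x i
    by (rule prob_space_measure_pmf)
  have sK: "sets (?K x) = sets ?P" for x
    by (rule sets_PiM_cong) simp_all
  have "?K \<in> measurable line_space (prob_algebra ?P)"
  proof (rule measurable_prob_algebra_generated[OF sets_PiM Int_stable_prod_algebra
        prod_algebra_sets_into_space])
    fix x show "prob_space (?K x)"
      by (intro prob_space_PiM Q)
    show "sets (?K x) = sets ?P" by (rule sK)
  next
    fix A assume "A \<in> prod_algebra ?I (\<lambda>_. count_space UNIV :: (bool \<times> bool) measure)"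
    then obtain J E where A: "A = prod_emb ?I (\<lambda>_. count_space UNIV) J (Pi\<^sub>E J E)"
      and J: "finite J" "J \<subseteq> ?I"
      by (auto elim!: prod_algebraE)
    have eq: "emeasure (?K x) A = (\<Prod>i\<in>J. emeasure (?Q x i) (E i))" for x
    proof -
      have "A = prod_emb ?I (?Q x) J (Pi\<^sub>E J E)"
        unfolding A prod_emb_def by simp
      then show ?thesis
        by (simp only:) (rule emeasure_PiM_emb[OF Q J(2) J(1)], simp)
    qed
    have "(\<lambda>x. emeasure (?Q x i) (E i)) \<in> borel_measurable line_space" for i
    proof -
      have c: "(\<lambda>x. x k) \<in> measurable line_space (count_space UNIV)" for k
        unfolding line_space_def by (rule measurable_component_singleton) simp
      have "(\<lambda>x. (x i, x (i + 1))) \<in> measurable line_space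
              (count_space UNIV \<Otimes>\<^sub>M count_space UNIV)"
        by (intro measurable_Pair c)
      then have "(\<lambda>x. (x i, x (i + 1))) \<in> measurable line_space (count_space UNIV)"
        by (simp add: pair_measure_countable)
      then show ?thesis by (rule measurable_compose) simp
    qed
    then show "(\<lambda>x. emeasure (?K x) A) \<in> borel_measurable line_space"
      unfolding eq by (intro borel_measurable_prod_ennreal) auto
  qed
  then have K: "?K \<in> measurable line_space (subprob_algebra ?P)"
    by (rule measurable_prob_algebraD)
  have "join_pairs t \<in> measurable ?P line_space"
    using measurable_join_pairs[of t "\<lambda>_. undefined"]
    by (subst measurable_cong_sets[OF sets_PiM_cong refl]) auto
  then have "(\<lambda>x. distr (?K x) line_space (join_pairs t)) \<in> measurable line_space (subprob_algebra line_space)"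
    using K by (rule measurable_compose[OF _ measurable_distr, rotated])
  then show ?thesis by (simp add: line_kernel_def[abs_def])
qed

lemma Ionescu_Tulcea_chain_kernel:
  assumes "prob_space \<mu>" and "sets \<mu> = sets line_space"
  shows "Ionescu_Tulcea (chain_kernel \<mu> p r) (\<lambda>_. line_space)"
proof (rule Ionescu_Tulcea.intro)
  fix n
  show "chain_kernel \<mu> p r n \<in> measurable (PiM {0..<n} (\<lambda>_. line_space)) (subprob_algebra line_space)"
  proof (cases n)
    case 0
    have "\<mu> \<in> space (subprob_algebra line_space)"
      using assms by (simp add: space_subprob_algebra prob_space_imp_subprob_space)
    with 0 show ?thesis by (simp add: fun_eq_iff measurable_const cong: measurable_cong)
  next
    case (Suc t)
    have "(\<lambda>h. h t) \<in> measurable (PiM {0..<Suc t} (\<lambda>_. line_space)) line_space"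
      by (rule measurable_component_singleton) simp
    then have "(\<lambda>h. line_kernel p r t (h t)) \<in>
        measurable (PiM {0..<Suc t} (\<lambda>_. line_space)) (subprob_algebra line_space)"
      by (rule measurable_compose[OF _ measurable_line_kernel])
    moreover have "chain_kernel \<mu> p r n = (\<lambda>h. line_kernel p r t (h t))"
      using Suc by (intro ext) simp
    ultimately show ?thesis using Suc by (simp only:)
  qed
  fix h
  show "prob_space (chain_kernel \<mu> p r n h)"
    using assms by (cases n) (simp_all add: prob_space_line_kernel)
qed

text \<open>The law of the Markov chain of lines, as the Ionescu-Tulcea limit.\<close>

definition chain_law ::
  "(int \<Rightarrow> bool) measure \<Rightarrow> real \<Rightarrow> real \<Rightarrow> (nat \<Rightarrow> int \<Rightarrow> bool) measure" where
  "chain_law \<mu> p r =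
     projective_family.lim UNIV
       (Ionescu_Tulcea.CI (chain_kernel \<mu> p r) (\<lambda>_. line_space)) (\<lambda>_. line_space)"

definition edge_law ::
  "(int \<Rightarrow> bool) measure \<Rightarrow> real \<Rightarrow> real \<Rightarrow> (int \<times> nat \<Rightarrow> bool) measure" where
  "edge_law \<mu> p r = distr (chain_law \<mu> p r) field_space (\<lambda>\<omega> (i, t). \<omega> t i)"

definition has_edge_law ::
  "'w measure \<Rightarrow> (int \<Rightarrow> nat \<Rightarrow> 'w \<Rightarrow> bool) \<Rightarrow> (int \<Rightarrow> bool) measure \<Rightarrow> real \<Rightarrow> real \<Rightarrow> bool" where
  "has_edge_law M e \<mu> p r \<longleftrightarrow>
     prob_space M \<and>
     (\<forall>i t. e i t \<in> measurable M (count_space UNIV)) \<and>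
     distr M field_space (\<lambda>\<omega> (i, t). e i t \<omega>) = edge_law \<mu> p r"

definition covariance :: "'w measure \<Rightarrow> ('w \<Rightarrow> real) \<Rightarrow> ('w \<Rightarrow> real) \<Rightarrow> real" where
  "covariance M X Y =
     (\<integral>\<omega>. (X \<omega> - (\<integral>\<omega>'. X \<omega>' \<partial>M)) * (Y \<omega> - (\<integral>\<omega>'. Y \<omega>' \<partial>M)) \<partial>M)"

definition edge_value :: "(int \<Rightarrow> nat \<Rightarrow> 'w \<Rightarrow> bool) \<Rightarrow> int \<times> nat \<Rightarrow> 'w \<Rightarrow> real" where
  "edge_value e z \<omega> = of_bool (e (fst z) (snd z) \<omega>)"

definition edge_var :: "'w measure \<Rightarrow> (int \<Rightarrow> nat \<Rightarrow> 'w \<Rightarrow> bool) \<Rightarrow> int \<times> nat \<Rightarrow> real" where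
  "edge_var M e z = prob_space.variance M (edge_value e z)"

definition edge_corr ::
  "'w measure \<Rightarrow> (int \<Rightarrow> nat \<Rightarrow> 'w \<Rightarrow> bool) \<Rightarrow> int \<times> nat \<Rightarrow> int \<times> nat \<Rightarrow> real" where
  "edge_corr M e z z' =
     covariance M (edge_value e z) (edge_value e z') /
       (sqrt (edge_var M e z) * sqrt (edge_var M e z'))"

text \<open>The correlation depends on the law only, so \<open>C8\<close> may use the canonical field.\<close>

definition C8 :: "real \<Rightarrow> real \<Rightarrow> int \<Rightarrow> nat \<Rightarrow> real" where
  "C8 p r i t = edge_corr (edge_law PM_half p r) (\<lambda>i t \<omega>. \<omega> (i, t)) (0, 0) (i, t)"

definition lam :: "real \<Rightarrow> real \<Rightarrow> real" where
  "lam p r = max \<bar>1 - 2 * p\<bar> \<bar>1 - 2 * r\<bar>"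

end

theory Submission
  imports Defs
begin

text \<open>
  In terms of the centred variables \<open>s = e - 1/2\<close> the update rule is linear in the mean: the
  expected value of \<open>s\<close> at a site of line \<open>t + 1\<close>, given line \<open>t\<close>, is \<open>r - p\<close> times the value
  at the same site plus \<open>r + p - 1\<close> times the value at the other site of its pair. Hence the
  covariance of \<open>e(0,0)\<close> with \<open>e(i,t)\<close> satisfies the same linear recursion in \<open>t\<close> whatever
  \<open>\<mu>\<close> is, and so does its difference with \<open>Var(e(0,0))\<close> times the solution \<open>influence\<close> started
  from a unit mass at the origin. Initially that difference is at most \<open>Var(e(0,0))\<close> in absolute
  value, and each step contracts the supremum norm by \<open>\<bar>r - p\<bar> + \<bar>r + p - 1\<bar> = \<lambda>(p,r)\<close>.
  For \<open>\<mu> = PM(1/2)\<close> the difference vanishes and every edge has variance \<open>1/4\<close>, so that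
  \<open>C\<^sub>8\<close> equals \<open>influence\<close>. This gives the stronger bound \<open>\<lambda>(p,r)\<^sup>t\<close>.
\<close>

subsection \<open>One-step integration under the Ionescu-Tulcea limit\<close>

text \<open>\<open>CI J\<close> is the marginal on \<open>J\<close> of the chain run for
  \<open>up_to J\<close> steps. On an initial segment nothing is cut off, so the composed kernel
  itself remains.\<close>

lemma (in Ionescu_Tulcea) CI_interval: "CI {0..<n} = C 0 n (\<lambda>_. undefined)"
proof -
  have "up_to {0..<n} = n"
  proof (rule antisym)
    show "up_to {0..<n} \<le> n"
      by (simp add: up_to_iff_Ico)
    show "n \<le> up_to {0..<n}"
      using up_to[of "{0..<n}"] by (simp only: ivl_subset finite_atLeastLessThan) auto
  qed
  then show ?thesis
    unfolding CI_def using distr_C[of n n "\<lambda>_. undefined" 0] by simp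
qed

text \<open>The tower property at time \<open>n\<close>. The first \<open>n + 1\<close> coordinates
  have law \<open>C 0 (Suc n)\<close>, which is \<open>C 0 n\<close> bound to \<open>eP n\<close>,
  and \<open>eP n x\<close> is the law of \<open>x(n := y)\<close> for \<open>y\<close> drawn from
  \<open>P n x\<close>.\<close>

lemma (in Ionescu_Tulcea) integral_lim_step:
  fixes f :: "(nat \<Rightarrow> 'a) \<Rightarrow> real"
  assumes f[measurable]: "f \<in> borel_measurable (PiM {0..<Suc n} M)"
    and bounded: "\<And>x. \<bar>f x\<bar> \<le> B"
  shows "(\<integral>\<omega>. f (restrict \<omega> {0..<Suc n}) \<partial>PF.lim)
    = (\<integral>\<omega>. (\<integral>y. f ((restrict \<omega> {0..<n})(n := y)) \<partial>P n (restrict \<omega> {0..<n})) \<partial>PF.lim)"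
proof -
  let ?u = "\<lambda>_. undefined :: 'a"
  let ?g = "\<lambda>x. \<integral>y. f (x(n := y)) \<partial>P n x"
  have u: "?u \<in> space (PiM {0..<0} M)"
    by (simp add: space_PiM)
  have restrict: "(\<lambda>\<omega>. restrict \<omega> {0..<m}) \<in> measurable PF.lim (PiM {0..<m} M)" for m
    by (subst measurable_cong_sets[OF PF.sets_lim refl]) (rule measurable_restrict_subset, simp)
  have marginal: "distr PF.lim (PiM {0..<m} M) (\<lambda>\<omega>. restrict \<omega> {0..<m}) = C 0 m ?u" for m
    using distr_lim[of "{0..<m}"] by (simp add: CI_interval)
  have eP: "integral\<^sup>L (eP n x) f = ?g x" if x: "x \<in> space (PiM {0..<n} M)" for x
    unfolding eP_def
    by (rule integral_distr[OF measurable_fun_upd[where J="{0..<n}"] f])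
       (use x in \<open>auto simp: atLeastLessThanSuc\<close>)
  \<comment> \<open>Measurability of \<open>?g\<close> is inherited from the kernel
    \<open>eP n\<close>, with which it agrees on the space of histories.\<close>
  have "(\<lambda>x. integral\<^sup>L (eP n x) f) \<in> borel_measurable (PiM {0..<n} M)"
    by (rule integral_measurable_subprob_algebra[OF f, THEN measurable_compose[OF measurable_eP]])
  with eP have g: "?g \<in> borel_measurable (PiM {0..<n} M)"
    by (simp cong: measurable_cong)
  have sp: "space (C 0 n ?u) = space (PiM {0..<n} M)"
    using space_C[OF u, of n] by simp
  have "(\<integral>\<omega>. f (restrict \<omega> {0..<Suc n}) \<partial>PF.lim) = integral\<^sup>L (C 0 (Suc n) ?u) f"
    unfolding marginal[symmetric] by (rule integral_distr[symmetric, OF restrict f])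
  also have "\<dots> = (\<integral>x. integral\<^sup>L (eP n x) f \<partial>C 0 n ?u)"
    unfolding C.simps add_0
  proof (rule integral_bind[where K="PiM {0..<Suc n} M" and B=B and B'=1])
    show "eP n \<in> measurable (C 0 n ?u) (subprob_algebra (PiM {0..<Suc n} M))"
      using measurable_eP sets_C[OF u, of n] by (simp cong: measurable_cong_sets)
    show "finite_measure (C 0 n ?u)"
      using prob_space_C[OF u, of n] by (simp add: prob_space_def)
    show "AE x in C 0 n ?u. emeasure (eP n x) (space (eP n x)) \<le> ennreal 1"
      using prob_space_eP by (intro AE_I2) (simp add: sp prob_space.emeasure_space_1)
  qed (use f bounded in auto)
  also have "\<dots> = (\<integral>x. ?g x \<partial>C 0 n ?u)"
    by (intro Bochner_Integration.integral_cong refl) (simp add: sp eP)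
  also have "\<dots> = (\<integral>\<omega>. ?g (restrict \<omega> {0..<n}) \<partial>PF.lim)"
    unfolding marginal[symmetric] by (rule integral_distr[OF restrict g])
  finally show ?thesis .
qed

subsection \<open>The one-step recursion for edges\<close>

definition spin :: "bool \<Rightarrow> real" where
  "spin k = of_bool k - 1 / 2"

text \<open>The involution that swaps the two sites of each pair updated between lines
  \<open>t\<close> and \<open>t + 1\<close>.\<close>

definition partner :: "nat \<Rightarrow> int \<Rightarrow> int" where
  "partner t j = (if even (j + int t) then j + 1 else j - 1)"

lemma integral_pair_step:
  fixes F :: "bool \<times> bool \<Rightarrow> real"
  assumes "0 \<le> p" "p \<le> 1" "0 \<le> r" "r \<le> 1"
  shows "measure_pmf.expectation (pair_step p r (k, l)) F =
    (if k = l then r * F (k, k) + (1 - r) * F (\<not> k, \<not> k) else p * F (l, k) + (1 - p) * F (k, l))"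
  using assms by (simp add: pair_step_def)

text \<open>The mean new spin is \<open>2 * r - 1\<close> times the old one if the pair has equal
  entries, and \<open>1 - 2 * p\<close> times it if they differ. These are the sum and the
  difference of \<open>r - p\<close> and \<open>r + p - 1\<close>, so one linear formula covers both
  cases.\<close>

lemma integral_spin_line_kernel:
  assumes "0 \<le> p" "p \<le> 1" "0 \<le> r" "r \<le> 1"
  shows "(\<integral>y. spin (y j) \<partial>line_kernel p r t x) =
    (r - p) * spin (x j) + (r + p - 1) * spin (x (partner t j))"
proof -
  let ?I = "{i. even (i + int t)}"
  let ?q = "\<lambda>i. measure_pmf (pair_step p r (x i, x (i + 1)))"
  have coord: "(\<lambda>y. spin (y j)) \<in> borel_measurable line_space"
    unfolding line_space_def
    by (rule measurable_compose[OF measurable_component_singleton]) auto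
  \<comment> \<open>A site of the new line reads a single pair, so only one marginal of the product
    matters.\<close>
  have component: "(\<integral>w. F (w i) \<partial>PiM ?I ?q) = integral\<^sup>L (?q i) F"
    if "i \<in> ?I" for i and F :: "bool \<times> bool \<Rightarrow> real"
  proof -
    have "integral\<^sup>L (?q i) F = integral\<^sup>L (distr (PiM ?I ?q) (?q i) (\<lambda>w. w i)) F"
      using that by (subst distr_PiM_component) (auto intro: prob_space_measure_pmf)
    also have "\<dots> = (\<integral>w. F (w i) \<partial>PiM ?I ?q)"
      using that by (intro integral_distr measurable_component_singleton) auto
    finally show ?thesis ..
  qed
  have "(\<integral>y. spin (y j) \<partial>line_kernel p r t x) = (\<integral>w. spin (join_pairs t w j) \<partial>PiM ?I ?q)"
    unfolding line_kernel_def by (rule integral_distr[OF measurable_join_pairs coord])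
  also have "\<dots> = (r - p) * spin (x j) + (r + p - 1) * spin (x (partner t j))"
  proof (cases "even (j + int t)")
    case True
    then have "(\<integral>w. spin (join_pairs t w j) \<partial>PiM ?I ?q) = (\<integral>v. spin (fst v) \<partial>?q j)"
      using component[of j "\<lambda>v. spin (fst v)"] by (simp add: join_pairs_def)
    also have "\<dots> = (r - p) * spin (x j) + (r + p - 1) * spin (x (j + 1))"
      using assms by (simp add: integral_pair_step spin_def field_simps)
    finally show ?thesis
      using True by (simp add: partner_def)
  next
    case False
    then have "(\<integral>w. spin (join_pairs t w j) \<partial>PiM ?I ?q) = (\<integral>v. spin (snd v) \<partial>?q (j - 1))"
      using component[of "j - 1" "\<lambda>v. spin (snd v)"] by (simp add: join_pairs_def)
    also have "\<dots> = (r - p) * spin (x j) + (r + p - 1) * spin (x (j - 1))"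
      using assms by (simp add: integral_pair_step spin_def field_simps)
    finally show ?thesis
      using False by (simp add: partner_def)
  qed
  finally show ?thesis .
qed

lemma
  fixes f g :: "(int \<Rightarrow> bool) \<Rightarrow> real"
  assumes \<mu>: "prob_space \<mu>" "sets \<mu> = sets line_space"
  shows prob_space_chain_law: "prob_space (chain_law \<mu> p r)"
    and sets_chain_law: "sets (chain_law \<mu> p r) = sets (PiM UNIV (\<lambda>_. line_space))"
    and integral_chain_law_0:
      "g \<in> borel_measurable line_space \<Longrightarrow> (\<And>x. \<bar>g x\<bar> \<le> B) \<Longrightarrow>
        (\<integral>\<omega>. g (\<omega> 0) \<partial>chain_law \<mu> p r) = (\<integral>x. g x \<partial>\<mu>)"
    and integral_chain_law_Suc:
      "g \<in> borel_measurable line_space \<Longrightarrow> (\<And>x. \<bar>g x\<bar> \<le> B) \<Longrightarrow>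
        f \<in> borel_measurable line_space \<Longrightarrow> (\<And>x. \<bar>f x\<bar> \<le> B') \<Longrightarrow>
        (\<integral>\<omega>. f (\<omega> 0) * g (\<omega> (Suc t)) \<partial>chain_law \<mu> p r) =
        (\<integral>\<omega>. f (\<omega> 0) * (\<integral>y. g y \<partial>line_kernel p r t (\<omega> t)) \<partial>chain_law \<mu> p r)"
proof -
  interpret I: Ionescu_Tulcea "chain_kernel \<mu> p r" "\<lambda>_. line_space"
    by (rule Ionescu_Tulcea_chain_kernel[OF \<mu>])
  have law: "chain_law \<mu> p r = I.PF.lim"
    by (simp add: chain_law_def)
  show sets: "sets (chain_law \<mu> p r) = sets (PiM UNIV (\<lambda>_. line_space))"
    by (simp add: law)
  show prob: "prob_space (chain_law \<mu> p r)"
  proof -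
    \<comment> \<open>The total mass is read off from the marginal on the empty set of
      indices.\<close>
    have "distr I.PF.lim (PiM {} (\<lambda>_. line_space)) (\<lambda>\<omega>. restrict \<omega> {}) = I.CI {}"
      by (rule I.distr_lim) simp
    moreover have "prob_space (I.CI {})"
      by (rule I.PF.prob_space_P) auto
    ultimately have "prob_space (distr I.PF.lim (PiM {} (\<lambda>_. line_space)) (\<lambda>\<omega>. restrict \<omega> {}))"
      by simp
    then show ?thesis
      unfolding law
      by (rule prob_space_distrD[rotated])
        (subst measurable_cong_sets[OF I.PF.sets_lim refl], rule measurable_restrict_subset, simp)
  qed
  then interpret chain: prob_space "chain_law \<mu> p r" .
  show "(\<integral>\<omega>. g (\<omega> 0) \<partial>chain_law \<mu> p r) = (\<integral>x. g x \<partial>\<mu>)"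
    if "g \<in> borel_measurable line_space" "\<And>x. \<bar>g x\<bar> \<le> B" for g :: "(int \<Rightarrow> bool) \<Rightarrow> real"
  proof -
    \<comment> \<open>The tower property at time 0: the history is empty and the kernel is \<mu>, so
      the outer integral is over a constant.\<close>
    have "(\<lambda>x. g (x 0)) \<in> borel_measurable (PiM {0..<Suc 0} (\<lambda>_. line_space))"
      by (rule measurable_compose[OF _ that(1)], rule measurable_component_singleton) simp
    from I.integral_lim_step[OF this that(2)] show ?thesis
      by (simp add: law[symmetric] chain.prob_space)
  qed
  show "(\<integral>\<omega>. f (\<omega> 0) * g (\<omega> (Suc t)) \<partial>chain_law \<mu> p r) =
      (\<integral>\<omega>. f (\<omega> 0) * (\<integral>y. g y \<partial>line_kernel p r t (\<omega> t)) \<partial>chain_law \<mu> p r)"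
    if g: "g \<in> borel_measurable line_space" "\<And>x. \<bar>g x\<bar> \<le> B"
      and f: "f \<in> borel_measurable line_space" "\<And>x. \<bar>f x\<bar> \<le> B'"
    for f g :: "(int \<Rightarrow> bool) \<Rightarrow> real"
  proof -
    have "(\<lambda>x. f (x 0) * g (x (Suc t))) \<in> borel_measurable (PiM {0..<Suc (Suc t)} (\<lambda>_. line_space))"
      by (intro borel_measurable_times measurable_compose[OF _ f(1)] measurable_compose[OF _ g(1)]
          measurable_component_singleton) auto
    moreover have "\<bar>f x * g y\<bar> \<le> B' * B" for x y
      using mult_mono[OF f(2)[of x] g(2)[of y]] f(2)[of x] by (simp add: abs_mult)
    \<comment> \<open>The update at index \<open>Suc t\<close> leaves index 0 alone, so
      \<open>f (x 0)\<close> leaves the inner integral.\<close>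
    ultimately show ?thesis
      using I.integral_lim_step[of "\<lambda>x. f (x 0) * g (x (Suc t))" "Suc t" "B' * B"]
      by (simp add: law[symmetric])
  qed
qed

text \<open>Both sides integrate the same function of the field against \<open>edge_law\<close>.
  This moves two-edge expectations from an arbitrary probability space to the chain of
  lines.\<close>

lemma integral_has_edge_law:
  fixes F :: "bool \<Rightarrow> bool \<Rightarrow> real"
  assumes \<mu>: "prob_space \<mu>" "sets \<mu> = sets line_space" and law: "has_edge_law M e \<mu> p r"
  shows "(\<integral>\<omega>. F (e i t \<omega>) (e j u \<omega>) \<partial>M) = (\<integral>\<omega>. F (\<omega> t i) (\<omega> u j) \<partial>chain_law \<mu> p r)"
proof -
  let ?G = "\<lambda>\<omega> :: int \<times> nat \<Rightarrow> bool. F (\<omega> (i, t)) (\<omega> (j, u))"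
  have e: "e i t \<in> measurable M (count_space UNIV)" for i t
    using law by (simp add: has_edge_law_def)
  have coord: "(\<lambda>\<omega>. \<omega> z) \<in> measurable field_space (count_space UNIV)" for z
    unfolding field_space_def by (rule measurable_component_singleton) simp
  have line: "(\<lambda>x. x i) \<in> measurable line_space (count_space UNIV)" for i
    unfolding line_space_def by (rule measurable_component_singleton) simp
  have "(\<lambda>\<omega>. (\<omega> (i, t), \<omega> (j, u))) \<in> measurable field_space (count_space UNIV \<Otimes>\<^sub>M count_space UNIV)"
    by (intro measurable_Pair coord)
  then have "(\<lambda>\<omega>. (\<omega> (i, t), \<omega> (j, u))) \<in> measurable field_space (count_space UNIV)"
    by (simp add: pair_measure_countable)
  then have "(\<lambda>\<omega>. case_prod F (\<omega> (i, t), \<omega> (j, u))) \<in> borel_measurable field_space"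
    by (rule measurable_compose) simp
  then have G: "?G \<in> borel_measurable field_space"
    by simp
  have eM: "(\<lambda>\<omega> (i, t). e i t \<omega>) \<in> measurable M field_space"
    unfolding field_space_def
    by (rule measurable_PiM_single') (auto simp: e space_PiM)
  have "(\<lambda>\<omega> (i, t). \<omega> t i) \<in> measurable (PiM UNIV (\<lambda>_. line_space)) field_space"
    unfolding field_space_def
    by (rule measurable_PiM_single')
      (auto intro!: measurable_compose[OF _ line] measurable_component_singleton)
  then have chain: "(\<lambda>\<omega> (i, t). \<omega> t i) \<in> measurable (chain_law \<mu> p r) field_space"
    by (subst measurable_cong_sets[OF sets_chain_law[OF \<mu>] refl])
  have "(\<integral>\<omega>. F (e i t \<omega>) (e j u \<omega>) \<partial>M) = integral\<^sup>L (distr M field_space (\<lambda>\<omega> (i, t). e i t \<omega>)) ?G"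
    using integral_distr[OF eM G] by simp
  also have "\<dots> = integral\<^sup>L (edge_law \<mu> p r) ?G"
    using law by (simp add: has_edge_law_def)
  also have "\<dots> = (\<integral>\<omega>. F (\<omega> t i) (\<omega> u j) \<partial>chain_law \<mu> p r)"
    unfolding edge_law_def using integral_distr[OF chain G] by simp
  finally show ?thesis .
qed

text \<open>Makes the canonical field behind \<open>C8\<close> accessible to the lemmas about
  \<open>M\<close> and \<open>e\<close>.\<close>

lemma has_edge_law_edge_law:
  assumes \<mu>: "prob_space \<mu>" "sets \<mu> = sets line_space"
  shows "has_edge_law (edge_law \<mu> p r) (\<lambda>i t \<omega>. \<omega> (i, t)) \<mu> p r"
proof -
  have line: "(\<lambda>x. x i) \<in> measurable line_space (count_space UNIV)" for i
    unfolding line_space_def by (rule measurable_component_singleton) simp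
  have "(\<lambda>\<omega> (i, t). \<omega> t i) \<in> measurable (PiM UNIV (\<lambda>_. line_space)) field_space"
    unfolding field_space_def
    by (rule measurable_PiM_single')
      (auto intro!: measurable_compose[OF _ line] measurable_component_singleton)
  then have "(\<lambda>\<omega> (i, t). \<omega> t i) \<in> measurable (chain_law \<mu> p r) field_space"
    by (subst measurable_cong_sets[OF sets_chain_law[OF \<mu>] refl])
  then have "prob_space (edge_law \<mu> p r)"
    unfolding edge_law_def by (rule prob_space.prob_space_distr[OF prob_space_chain_law[OF \<mu>]])
  moreover have "(\<lambda>\<omega>. \<omega> z) \<in> measurable (edge_law \<mu> p r) (count_space UNIV)" for z
    unfolding edge_law_def measurable_distr_eq1 field_space_def
    by (rule measurable_component_singleton) simp
  moreover have "distr (edge_law \<mu> p r) field_space (\<lambda>\<omega> (i, t). \<omega> (i, t)) = edge_law \<mu> p r"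
    by (simp add: distr_id2 edge_law_def)
  ultimately show ?thesis
    by (simp add: has_edge_law_def)
qed

text \<open>The weight \<open>h\<close> is left free for three uses: a constant gives means,
  \<open>spin\<close> gives second moments, and the centred edge at the origin gives
  covariances.\<close>

lemma integral_spin_Suc:
  assumes \<mu>: "prob_space \<mu>" "sets \<mu> = sets line_space" and law: "has_edge_law M e \<mu> p r"
    and pr: "0 \<le> p" "p \<le> 1" "0 \<le> r" "r \<le> 1"
  shows "(\<integral>\<omega>. h (e 0 0 \<omega>) * spin (e i (Suc t) \<omega>) \<partial>M) =
    (r - p) * (\<integral>\<omega>. h (e 0 0 \<omega>) * spin (e i t \<omega>) \<partial>M) +
    (r + p - 1) * (\<integral>\<omega>. h (e 0 0 \<omega>) * spin (e (partner t i) t \<omega>) \<partial>M)"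
proof -
  let ?L = "chain_law \<mu> p r"
  interpret prob_space ?L
    by (rule prob_space_chain_law[OF \<mu>])
  have line: "(\<lambda>x. F (x i)) \<in> borel_measurable line_space" for i and F :: "bool \<Rightarrow> real"
    unfolding line_space_def by (rule measurable_compose[OF measurable_component_singleton]) auto
  have "(\<lambda>\<omega>. F (\<omega> t i)) \<in> borel_measurable (PiM UNIV (\<lambda>_. line_space))"
    for i t and F :: "bool \<Rightarrow> real"
    by (rule measurable_compose[OF _ line], rule measurable_component_singleton) simp
  then have chain: "(\<lambda>\<omega>. F (\<omega> t i)) \<in> borel_measurable ?L" for i t and F :: "bool \<Rightarrow> real"
    by (subst measurable_cong_sets[OF sets_chain_law[OF \<mu>] refl])
  have h: "\<bar>h k\<bar> \<le> \<bar>h True\<bar> + \<bar>h False\<bar>" for k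
    by (cases k) auto
  have spin: "\<bar>spin k\<bar> \<le> 1" for k
    by (simp add: spin_def)
  have int: "integrable ?L (\<lambda>\<omega>. h (\<omega> 0 0) * spin (\<omega> t i))" for i t
  proof (rule integrable_const_bound)
    show "AE \<omega> in ?L. norm (h (\<omega> 0 0) * spin (\<omega> t i)) \<le> (\<bar>h True\<bar> + \<bar>h False\<bar>) * 1"
      unfolding real_norm_def abs_mult by (intro AE_I2 mult_mono h spin) auto
  qed (intro borel_measurable_times chain)
  have "(\<integral>\<omega>. h (e 0 0 \<omega>) * spin (e i (Suc t) \<omega>) \<partial>M) = (\<integral>\<omega>. h (\<omega> 0 0) * spin (\<omega> (Suc t) i) \<partial>?L)"
    by (rule integral_has_edge_law[OF \<mu> law])
  also have "\<dots> = (\<integral>\<omega>. h (\<omega> 0 0) * (\<integral>y. spin (y i) \<partial>line_kernel p r t (\<omega> t)) \<partial>?L)"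
    using integral_chain_law_Suc[OF \<mu> line[of spin i] spin line[of h 0] h] .
  also have "\<dots> = (\<integral>\<omega>. (r - p) * (h (\<omega> 0 0) * spin (\<omega> t i)) +
      (r + p - 1) * (h (\<omega> 0 0) * spin (\<omega> t (partner t i))) \<partial>?L)"
    by (simp add: integral_spin_line_kernel[OF pr] algebra_simps)
  also have "\<dots> = (r - p) * (\<integral>\<omega>. h (\<omega> 0 0) * spin (\<omega> t i) \<partial>?L) +
      (r + p - 1) * (\<integral>\<omega>. h (\<omega> 0 0) * spin (\<omega> t (partner t i)) \<partial>?L)"
    using int by simp
  finally show ?thesis
    by (simp only: integral_has_edge_law[OF \<mu> law, of "\<lambda>k l. h k * spin l"])
qed

subsection \<open>Covariances with the origin\<close>

lemma prob_space_PM_half: "prob_space PM_half"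
  unfolding PM_half_def by (intro prob_space_PiM prob_space_measure_pmf)

lemma sets_PM_half: "sets PM_half = sets line_space"
  unfolding PM_half_def line_space_def by (rule sets_PiM_cong) simp_all

lemma integral_spin_PM_half:
  "(\<integral>x. spin (x i) \<partial>PM_half) = 0"
  "(\<integral>x. spin (x i) * spin (x j) \<partial>PM_half) = of_bool (i = j) / 4"
proof -
  let ?B = "measure_pmf (bernoulli_pmf (1 / 2))"
  interpret B: product_prob_space "\<lambda>_. ?B" UNIV
    by unfold_locales
  have zero: "integral\<^sup>L ?B spin = 0"
    by (simp add: spin_def)
  have prod: "(\<integral>x. (\<Prod>i\<in>J. F i (x i)) \<partial>PM_half) = (\<Prod>i\<in>J. integral\<^sup>L ?B (F i))"
    if "finite J" for J and F :: "int \<Rightarrow> bool \<Rightarrow> real"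
  proof -
    \<comment> \<open>The integrand is made to depend on the restriction to \<open>J\<close> alone,
      whose law is a finite product measure.\<close>
    have "(\<integral>x. (\<Prod>i\<in>J. F i (x i)) \<partial>PM_half) =
        (\<integral>x. (\<Prod>i\<in>J. F i (restrict x J i)) \<partial>PM_half)"
      by (simp cong: prod.cong)
    also have "\<dots> = integral\<^sup>L (distr PM_half (PiM J (\<lambda>_. ?B)) (\<lambda>x. restrict x J)) (\<lambda>x. \<Prod>i\<in>J. F i (x i))"
      unfolding PM_half_def
      by (intro integral_distr[symmetric] measurable_restrict_subset borel_measurable_prod
          measurable_compose[OF measurable_component_singleton]) auto
    also have "\<dots> = (\<Prod>i\<in>J. integral\<^sup>L ?B (F i))"
      unfolding PM_half_def using that
      by (subst B.distr_PiM_restrict_finite)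
        (auto intro!: B.product_integral_prod integrable_measure_pmf_finite
          simp del: integral_bernoulli_pmf)
    finally show ?thesis .
  qed
  show "(\<integral>x. spin (x i) \<partial>PM_half) = 0"
    using prod[of "{i}" "\<lambda>_. spin"] zero by simp
  show "(\<integral>x. spin (x i) * spin (x j) \<partial>PM_half) = of_bool (i = j) / 4"
  proof (cases "i = j")
    case True
    then show ?thesis
      using prod[of "{i}" "\<lambda>_ k. spin k * spin k"] by (simp add: spin_def)
  next
    case False
    then show ?thesis
      using prod[of "{i, j}" "\<lambda>_. spin"] zero by simp
  qed
qed

fun influence :: "real \<Rightarrow> real \<Rightarrow> nat \<Rightarrow> int \<Rightarrow> real" where
  "influence p r 0 i = of_bool (i = 0)"
| "influence p r (Suc t) i =
    (r - p) * influence p r t i + (r + p - 1) * influence p r t (partner t i)"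

text \<open>For reals, |x| + |y| is the maximum of |x + y| and |x - y|; here the sum is
  \<open>2 * r - 1\<close> and the difference \<open>1 - 2 * p\<close>.\<close>

lemma abs_coefficients_le_lam: "\<bar>r - p\<bar> + \<bar>r + p - 1\<bar> \<le> lam p r"
  by (auto simp: lam_def abs_if max_def)

section \<open>Means, variances and covariances of edges\<close>

lemma
  fixes F G :: "bool \<Rightarrow> real"
  assumes law: "has_edge_law M e \<mu> p r"
  shows integrable_edge: "integrable M (\<lambda>\<omega>. F (e i t \<omega>))"
    and integrable_edge_mult: "integrable M (\<lambda>\<omega>. F (e i t \<omega>) * G (e j u \<omega>))"
proof -
  interpret prob_space M
    using law by (simp add: has_edge_law_def)
  have e: "e i t \<in> measurable M (count_space UNIV)" for i t
    using law by (simp add: has_edge_law_def)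
  have bound: "\<bar>F k\<bar> \<le> \<bar>F True\<bar> + \<bar>F False\<bar>" for F :: "bool \<Rightarrow> real" and k
    by (cases k) auto
  show "integrable M (\<lambda>\<omega>. F (e i t \<omega>))"
    by (rule integrable_const_bound[where B="\<bar>F True\<bar> + \<bar>F False\<bar>"])
      (simp_all add: bound measurable_compose[OF e])
  show "integrable M (\<lambda>\<omega>. F (e i t \<omega>) * G (e j u \<omega>))"
  proof (rule integrable_const_bound)
    show "AE \<omega> in M. norm (F (e i t \<omega>) * G (e j u \<omega>)) \<le> (\<bar>F True\<bar> + \<bar>F False\<bar>) * (\<bar>G True\<bar> + \<bar>G False\<bar>)"
      unfolding real_norm_def abs_mult by (intro AE_I2 mult_mono bound) auto
  qed (intro borel_measurable_times; simp add: measurable_compose[OF e])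
qed

lemma integral_of_bool_edge:
  assumes law: "has_edge_law M e \<mu> p r"
  shows "(\<integral>\<omega>. of_bool (e i t \<omega>) \<partial>M) = (\<integral>\<omega>. spin (e i t \<omega>) \<partial>M) + 1 / 2"
proof -
  interpret prob_space M
    using law by (simp add: has_edge_law_def)
  show ?thesis
    unfolding spin_def using integrable_edge[OF law, of of_bool i t] by (simp add: prob_space)
qed

lemma integral_affine_edge:
  fixes u v :: real
  assumes law: "has_edge_law M e \<mu> p r"
  shows "(\<integral>\<omega>. u * of_bool (e i t \<omega>) + v \<partial>M) = u * (\<integral>\<omega>. of_bool (e i t \<omega>) \<partial>M) + v"
proof -
  interpret prob_space M
    using law by (simp add: has_edge_law_def)
  show ?thesis
    using integrable_edge[OF law, of of_bool i t] by (simp add: prob_space)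
qed

text \<open>The square of a spin is always 1/4, so the variance depends on the mean only.\<close>

lemma edge_var_eq_spin:
  assumes law: "has_edge_law M e \<mu> p r"
  shows "edge_var M e (i, t) = 1 / 4 - (\<integral>\<omega>. spin (e i t \<omega>) \<partial>M)\<^sup>2"
proof -
  interpret prob_space M
    using law by (simp add: has_edge_law_def)
  let ?m = "\<integral>\<omega>. spin (e i t \<omega>) \<partial>M"
  have "edge_var M e (i, t) = (\<integral>\<omega>. (1 / 4 + ?m * ?m) - 2 * ?m * spin (e i t \<omega>) \<partial>M)"
    unfolding edge_var_def edge_value_def fst_conv snd_conv integral_of_bool_edge[OF law]
    by (intro Bochner_Integration.integral_cong refl)
      (auto simp: spin_def power2_eq_square field_simps)
  also have "\<dots> = 1 / 4 + ?m * ?m - 2 * ?m * ?m"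
    using integrable_edge[OF law, of spin i t] by (simp add: prob_space)
  finally show ?thesis
    by (simp add: power2_eq_square)
qed

text \<open>The first factor has mean zero, so shifting the second by a constant changes nothing.
  The result has the weighted form to which \<open>integral_spin_Suc\<close> applies.\<close>

lemma covariance_edge_value:
  assumes law: "has_edge_law M e \<mu> p r"
  shows "covariance M (edge_value e (0, 0)) (edge_value e (i, t)) =
    (\<integral>\<omega>. (of_bool (e 0 0 \<omega>) - (\<integral>\<omega>'. of_bool (e 0 0 \<omega>') \<partial>M)) * spin (e i t \<omega>) \<partial>M)"
proof -
  let ?q = "\<integral>\<omega>. of_bool (e 0 0 \<omega>) \<partial>M :: real"
  let ?m = "\<integral>\<omega>. spin (e i t \<omega>) \<partial>M"
  have "covariance M (edge_value e (0, 0)) (edge_value e (i, t)) =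
      (\<integral>\<omega>. (of_bool (e 0 0 \<omega>) - ?q) * spin (e i t \<omega>) - (?m * of_bool (e 0 0 \<omega>) + - ?m * ?q) \<partial>M)"
    unfolding covariance_def edge_value_def fst_conv snd_conv integral_of_bool_edge[OF law, of i t]
    by (intro Bochner_Integration.integral_cong refl) (simp add: spin_def algebra_simps)
  also have "\<dots> = (\<integral>\<omega>. (of_bool (e 0 0 \<omega>) - ?q) * spin (e i t \<omega>) \<partial>M) -
      (\<integral>\<omega>. ?m * of_bool (e 0 0 \<omega>) + - ?m * ?q \<partial>M)"
    using integrable_edge_mult[OF law, of "\<lambda>k. of_bool k - ?q" 0 0 spin i t]
      integrable_edge[OF law, of "\<lambda>k. ?m * of_bool k + - ?m * ?q" 0 0]
    by (rule Bochner_Integration.integral_diff)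
  finally show ?thesis
    unfolding integral_affine_edge[OF law] by simp
qed

text \<open>Since |spin| = 1/2, the covariance is at most E|X - q| / 2 for the indicator X at the
  origin with mean q, and this equals q(1 - q) = Var X. Cauchy-Schwarz would bring in the variance
  at \<open>(i, t)\<close> as well.\<close>

lemma abs_covariance_le_edge_var:
  assumes law: "has_edge_law M e \<mu> p r"
  shows "\<bar>covariance M (edge_value e (0, 0)) (edge_value e (i, t))\<bar> \<le> edge_var M e (0, 0)"
proof -
  interpret prob_space M
    using law by (simp add: has_edge_law_def)
  define q :: real where "q = (\<integral>\<omega>. of_bool (e 0 0 \<omega>) \<partial>M)"
  have q: "0 \<le> q" "q \<le> 1"
    using integral_ge_const[OF integrable_edge[OF law, of of_bool 0 0], of 0]
      integral_le_const[OF integrable_edge[OF law, of of_bool 0 0], of 1]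
    by (simp_all add: q_def)
  have "\<bar>\<integral>\<omega>. (of_bool (e 0 0 \<omega>) - q) * spin (e i t \<omega>) \<partial>M\<bar> \<le>
      (\<integral>\<omega>. \<bar>(of_bool (e 0 0 \<omega>) - q) * spin (e i t \<omega>)\<bar> \<partial>M)"
    by (rule integral_abs_bound)
  \<comment> \<open>The affine function of the indicator X with values (1 - q)/2 at 1 and q/2 at 0,
    that is |X - q|/2.\<close>
  also have "\<dots> \<le> (\<integral>\<omega>. (1 / 2 - q) * of_bool (e 0 0 \<omega>) + q / 2 \<partial>M)"
  proof (rule Bochner_Integration.integral_mono)
    show "\<bar>(of_bool (e 0 0 \<omega>) - q) * spin (e i t \<omega>)\<bar> \<le> (1 / 2 - q) * of_bool (e 0 0 \<omega>) + q / 2"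
      for \<omega>
      using q by (cases "e 0 0 \<omega>"; cases "e i t \<omega>") (auto simp: spin_def abs_mult field_simps)
  qed (rule integrable_abs[OF integrable_edge_mult[OF law, of "\<lambda>k. of_bool k - q" 0 0 spin i t]]
      integrable_edge[OF law, of "\<lambda>k. (1 / 2 - q) * of_bool k + q / 2" 0 0])+
  also have "\<dots> = (1 / 2 - q) * q + q / 2"
    unfolding integral_affine_edge[OF law] q_def ..
  also have "\<dots> = (1 - 2 * q) * q + q * q"
    by (simp add: algebra_simps)
  \<comment> \<open>The new integrand is (X - q)^2, written as an affine function of X.\<close>
  also have "\<dots> = (\<integral>\<omega>. (1 - 2 * q) * of_bool (e 0 0 \<omega>) + q * q \<partial>M)"
    unfolding integral_affine_edge[OF law] q_def ..
  also have "\<dots> = edge_var M e (0, 0)"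
    unfolding edge_var_def edge_value_def q_def[symmetric] fst_conv snd_conv
    by (intro Bochner_Integration.integral_cong refl) (auto simp: power2_eq_square algebra_simps)
  finally show ?thesis
    unfolding covariance_edge_value[OF law] q_def .
qed

lemma abs_covariance_diff_influence_le:
  assumes \<mu>: "prob_space \<mu>" "sets \<mu> = sets line_space" and law: "has_edge_law M e \<mu> p r"
    and pr: "0 \<le> p" "p \<le> 1" "0 \<le> r" "r \<le> 1"
  shows "\<bar>covariance M (edge_value e (0, 0)) (edge_value e (i, t)) -
      influence p r t i * edge_var M e (0, 0)\<bar> \<le> lam p r ^ t * edge_var M e (0, 0)"
proof (induction t arbitrary: i)
  case 0
  have nonneg: "0 \<le> edge_var M e (0, 0)"
    unfolding edge_var_def by (rule Bochner_Integration.integral_nonneg) simp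
  show ?case
  proof (cases "i = 0")
    case True
    \<comment> \<open>At the origin the covariance is the variance, so the difference
      vanishes.\<close>
    then show ?thesis
      using nonneg by (simp add: covariance_def edge_var_def power2_eq_square)
  next
    case False
    then show ?thesis
      using abs_covariance_le_edge_var[OF law] by simp
  qed
next
  case (Suc t)
  let ?V = "edge_var M e (0, 0)"
  let ?D = "\<lambda>t i. covariance M (edge_value e (0, 0)) (edge_value e (i, t)) - influence p r t i * ?V"
  have "?D (Suc t) i = (r - p) * ?D t i + (r + p - 1) * ?D t (partner t i)"
    unfolding covariance_edge_value[OF law]
    by (subst integral_spin_Suc[OF \<mu> law pr]) (simp add: algebra_simps)
  also have "\<bar>\<dots>\<bar> \<le> \<bar>r - p\<bar> * \<bar>?D t i\<bar> + \<bar>r + p - 1\<bar> * \<bar>?D t (partner t i)\<bar>"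
    by (rule order_trans[OF abs_triangle_ineq]) (simp add: abs_mult)
  also have "\<dots> \<le> \<bar>r - p\<bar> * (lam p r ^ t * ?V) + \<bar>r + p - 1\<bar> * (lam p r ^ t * ?V)"
    by (intro add_mono mult_left_mono Suc.IH) auto
  also have "\<dots> = (\<bar>r - p\<bar> + \<bar>r + p - 1\<bar>) * (lam p r ^ t * ?V)"
    by (simp add: algebra_simps)
  also have "\<dots> \<le> lam p r * (lam p r ^ t * ?V)"
  proof (rule mult_right_mono[OF abs_coefficients_le_lam])
    \<comment> \<open>By the induction hypothesis this number bounds an absolute value.\<close>
    show "0 \<le> lam p r ^ t * ?V"
      using Suc.IH[of i] by linarith
  qed
  finally show ?case
    by simp
qed

text \<open>The recursion keeps all mean spins at 0, and it carries the second moments with the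
  origin from 1/4 times a unit mass to \<open>influence / 4\<close>. Division by the common variance
  1/4 gives the claim.\<close>

lemma C8_eq_influence:
  assumes pr: "0 \<le> p" "p \<le> 1" "0 \<le> r" "r \<le> 1"
  shows "C8 p r i t = influence p r t i"
proof -
  let ?M = "edge_law PM_half p r" and ?e = "\<lambda>i t \<omega>. \<omega> (i, t) :: bool"
  note \<mu> = prob_space_PM_half sets_PM_half
  note law = has_edge_law_edge_law[OF \<mu>, of p r]
  have line: "(\<lambda>x. F (x i)) \<in> borel_measurable line_space" for i and F :: "bool \<Rightarrow> real"
    unfolding line_space_def by (rule measurable_compose[OF measurable_component_singleton]) auto
  have spin: "\<bar>spin k\<bar> \<le> 1" for k
    by (simp add: spin_def)
  then have "\<bar>spin k * spin l\<bar> \<le> 1 * 1" for k l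
    unfolding abs_mult by (intro mult_mono) auto
  then have spin2: "\<bar>spin k * spin l\<bar> \<le> 1" for k l
    by simp
  have mean: "(\<integral>\<omega>. spin (?e i t \<omega>) \<partial>?M) = 0" for i t
  proof (induction t arbitrary: i)
    case 0
    show ?case
      using integral_has_edge_law[OF \<mu> law, of "\<lambda>_. spin" 0 0 i 0]
        integral_chain_law_0[OF \<mu> line[of spin i] spin] integral_spin_PM_half(1)
      by simp
  next
    case (Suc t)
    then show ?case
      using integral_spin_Suc[OF \<mu> law pr, of "\<lambda>_. 1"] by simp
  qed
  have moment: "(\<integral>\<omega>. spin (?e 0 0 \<omega>) * spin (?e i t \<omega>) \<partial>?M) = influence p r t i / 4"
  proof (induction t arbitrary: i)
    case 0
    show ?case
      using integral_has_edge_law[OF \<mu> law, of "\<lambda>k l. spin k * spin l" 0 0 i 0]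
        integral_chain_law_0[OF \<mu> borel_measurable_times[OF line[of spin 0] line[of spin i]] spin2]
        integral_spin_PM_half(2)[of 0 i]
      by (cases "i = 0") simp_all
  next
    case (Suc t)
    show ?case
      unfolding influence.simps integral_spin_Suc[OF \<mu> law pr] Suc.IH by (simp add: field_simps)
  qed
  \<comment> \<open>With mean 1/2 the centred edge at the origin is its spin, so the covariance is
    \<open>moment\<close>.\<close>
  have half: "(\<integral>\<omega>. of_bool (?e 0 0 \<omega>) \<partial>?M) = (1 / 2 :: real)"
    using integral_of_bool_edge[OF law, of 0 0] mean[of 0 0] by simp
  have "covariance ?M (edge_value ?e (0, 0)) (edge_value ?e (i, t)) = influence p r t i / 4"
    unfolding covariance_edge_value[OF law] half moment[symmetric] by (simp add: spin_def)
  moreover have "edge_var ?M ?e (j, s) = 1 / 4" for j s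
    using edge_var_eq_spin[OF law, of j s] mean[of j s] by simp
  ultimately show ?thesis
    unfolding C8_def edge_corr_def by (simp only:) (simp add: real_sqrt_divide)
qed

theorem proposition1p13:
  fixes a b c d p r :: real
    and \<mu> :: "(int \<Rightarrow> bool) measure"
    and M :: "'w measure"
    and e :: "int \<Rightarrow> nat \<Rightarrow> 'w \<Rightarrow> bool"
    and i :: int and t :: nat
  assumes "a \<ge> 0" "b \<ge> 0" "c \<ge> 0" "d \<ge> 0"
    and "\<not> (a = 0 \<and> b = 0 \<and> c = 0 \<and> d = 0)"
    and "a + c = b + d"
    and "p = a / (a + c)" and "r = b / (b + d)"
    and "prob_space \<mu>" and "sets \<mu> = sets line_space"
    and "has_edge_law M e \<mu> p r"
    and "edge_var M e (0, 0) > 0" and "edge_var M e (i, t) > 0"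
    and "t \<ge> 1 \<or> lam p r > 0"
  shows "\<bar>sqrt (edge_var M e (i, t) / edge_var M e (0, 0)) * edge_corr M e (0, 0) (i, t) - C8 p r i t\<bar>
    \<le> 2 * (lam p r powi (int t - 1 - \<lfloor>real t / 2\<rfloor>) + lam p r powi \<lfloor>real t / 2\<rfloor>
           - lam p r powi (int t - 1))"
proof -
  let ?l = "lam p r" and ?V = "edge_var M e (0, 0)"
  let ?c = "covariance M (edge_value e (0, 0)) (edge_value e (i, t))"
  \<comment> \<open>Otherwise \<open>b + d\<close> is 0 too, and all four weights vanish.\<close>
  have "a + c > 0"
    using assms(1-6) by linarith
  then have pr: "0 \<le> p" "p \<le> 1" "0 \<le> r" "r \<le> 1"
    using assms(1-8) by (simp_all add: divide_le_eq)
  then have l: "0 \<le> ?l" "?l \<le> 1"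
    by (auto simp: lam_def)
  \<comment> \<open>The prefactor cancels the variance at \<open>(i, t)\<close> in the
    correlation.\<close>
  have "sqrt (edge_var M e (i, t) / ?V) * edge_corr M e (0, 0) (i, t) = ?c / ?V"
    using assms(12,13) by (simp add: edge_corr_def real_sqrt_divide)
  moreover have "?c / ?V - influence p r t i = (?c - influence p r t i * ?V) / ?V"
    using assms(12) by (simp add: diff_divide_distrib)
  moreover have "\<bar>\<dots>\<bar> \<le> ?l ^ t"
    using abs_covariance_diff_influence_le[OF assms(9-11) pr, of i t] assms(12)
    by (simp add: divide_le_eq)
  ultimately have "\<bar>sqrt (edge_var M e (i, t) / ?V) * edge_corr M e (0, 0) (i, t) - C8 p r i t\<bar> \<le> ?l ^ t"
    by (simp add: C8_eq_influence[OF pr])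
  also have "\<dots> \<le> 2 * (?l powi (int t - 1 - \<lfloor>real t / 2\<rfloor>) + ?l powi \<lfloor>real t / 2\<rfloor> - ?l powi (int t - 1))"
  proof (cases t)
    case 0
    \<comment> \<open>The two terms with exponent -1 cancel, leaving 1 on the left and 2 on the
      right.\<close>
    then show ?thesis by simp
  next
    case (Suc n)
    have floor: "\<lfloor>real t / 2\<rfloor> = int (t div 2)"
      using floor_divide_of_nat_eq[of t 2] by simp
    \<comment> \<open>For positive \<open>t\<close> the exponents are natural numbers, as
      \<open>t div 2\<close> is at most \<open>t - 1 = n\<close>.\<close>
    have exps: "int t - 1 - int (t div 2) = int (n - t div 2)" "int t - 1 = int n"
      using Suc by (simp_all add: of_nat_diff)
    \<comment> \<open>As \<open>?l\<close> is at most 1, the first term on the right outweighs the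
      subtracted one, and the middle term alone dominates \<open>?l ^ t\<close>.\<close>
    have "?l ^ n \<le> ?l ^ (n - t div 2)" "?l ^ t \<le> ?l ^ (t div 2)"
      using l by (intro power_decreasing; simp)+
    moreover have "0 \<le> ?l ^ t"
      using l by simp
    moreover have "w \<le> 2 * (x + y - z)" if "z \<le> x" "w \<le> y" "0 \<le> w" for w x y z :: real
      using that by simp
    ultimately show ?thesis
      unfolding floor exps(1) unfolding exps(2) power_int_of_nat by blast
  qed
  finally show ?thesis .
qed

end
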